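(* Let $(a_n)_{n\ge0}$ and $(t_n)_{n\ge0}$ be increasing sequences of natural numbers with $a_n>1$ for all $n$. Let $B=B(F_n)$ be the generalized Bratteli diagram with $V_n=\mathbb Z$ for all $n\in\mathbb N_0$ and incidence matrices $F_n=(f^{(n)}_{v,w})_{v,w\in\mathbb Z}$ given by $f^{(n)}_{0,0}=a_n$; $f^{(n)}_{v,w}=1$ if $(v,w)\ne(0,0)$ and $|v-w|\le t_n$; $f^{(n)}_{v,w}=0$ if $|v-w|>t_n$. Let $\overline B$ be the vertex subdiagram with $W_n=\{0\}$ for all $n$, and let $\overline\nu$ be its unique tail invariant probability measure, which gives the value $1/(a_0\cdots a_n)$ to every cylinder set of $X_{\overline B}$ determined by a finite path from level $0$ to level $n+1$. Then $$\sum_{n=0}^\infty\frac{t_n}{a_n}<\infty\ \Longrightarrow\ \widehat{\overline\nu}(\widehat X_{\overline B})<\infty.$$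
   Context: A generalized Bratteli diagram has countably infinite vertex sets $V_n$ ($n\in\mathbb N_0$) and edge sets $E_n$ between $V_n$ and $V_{n+1}$; the incidence matrix entry $f^{(n)}_{v,w}$ is the number of edges from $w\in V_n$ (source) to $v\in V_{n+1}$ (range). The path space $X_B$ is the set of infinite sequences $(x_n)$, $x_n\in E_n$, $r(x_n)=s(x_{n+1})$, with the topology generated by cylinder sets of finite paths starting in $V_0$. Two paths are tail equivalent (relation $\mathcal R$) if they agree from some index on. A vertex subdiagram with vertex sets $W_n\subset V_n$ contains all edges of $B$ with source in $W_n$ and range in $W_{n+1}$; here $\overline B$ is an odometer with $a_n$ edges between levels $n$ and $n+1$. Tail invariant measure: Borel measure giving equal value to cylinder sets whose defining finite paths from $V_0$ end at the same vertex. Measure extension: $\widehat X_{\overline B}\subset X_B$ is the set of all paths of $X_B$ tail equivalent (in $B$) to some path of $X_{\overline B}$; $\widehat{\overline\nu}$ is the unique $\mathcal R$-invariant Borel measure (possibly infinite) on $\widehat X_{\overline B}$ extending $\overline\nu$: for a finite path $f$ of $B$ from $V_0$ to $0\in V_n$, the set of paths that begin with $f$ and whose edges after $f$ all lie in $\overline B$ has $\widehat{\overline\nu}$-measure $1/(a_0\cdots a_{n-1})$. *)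

theory Defs
  imports "HOL-Probability.Probability"
begin

text \<open>Diagrams are layered: level \<open>n\<close> has the vertex set \<open>verts B n\<close>, and the edges in
  \<open>edges B n\<close> go from level \<open>n\<close> to level \<open>Suc n\<close>. The level is always passed explicitly, so
  the sets belonging to different levels need not be disjoint.\<close>

record ('v, 'e) bratteli =
  verts :: "nat \<Rightarrow> 'v set"
  edges :: "nat \<Rightarrow> 'e set"
  src :: "nat \<Rightarrow> 'e \<Rightarrow> 'v"
  rng :: "nat \<Rightarrow> 'e \<Rightarrow> 'v"

definition generalized_bratteli_diagram :: "('v, 'e) bratteli \<Rightarrow> bool" where
  "generalized_bratteli_diagram B \<longleftrightarrow>
     (\<forall>n. countable (verts B n) \<and> infinite (verts B n)) \<and>
     (\<forall>n. \<forall>e\<in>edges B n. src B n e \<in> verts B n \<and> rng B n e \<in> verts B (Suc n)) \<and>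
     (\<forall>n. \<forall>w\<in>verts B n. \<forall>v\<in>verts B (Suc n).
        finite {e \<in> edges B n. src B n e = w \<and> rng B n e = v})"

text \<open>The row index \<open>v\<close> is the range and the column index \<open>w\<close> is the source.\<close>

definition incidence :: "('v, 'e) bratteli \<Rightarrow> nat \<Rightarrow> 'v \<Rightarrow> 'v \<Rightarrow> nat" where
  "incidence B n v w = card {e \<in> edges B n. src B n e = w \<and> rng B n e = v}"

definition vertex_subdiagram ::
    "('v, 'e) bratteli \<Rightarrow> (nat \<Rightarrow> 'v set) \<Rightarrow> ('v, 'e) bratteli" where
  "vertex_subdiagram B W =
     B\<lparr>verts := W,
       edges := \<lambda>n. {e \<in> edges B n. src B n e \<in> W n \<and> rng B n e \<in> W (Suc n)}\<rparr>"

definition path_space :: "('v, 'e) bratteli \<Rightarrow> (nat \<Rightarrow> 'e) set" where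
  "path_space B =
     {x. \<forall>n. x n \<in> edges B n \<and> rng B n (x n) = src B (Suc n) (x (Suc n))}"

text \<open>Finite paths start at level 0 and have at least one edge. Nothing is lost by leaving out
  the paths of length 0: the set of all paths starting at a given vertex of level 0 is the union
  of the cylinder sets of the edges leaving that vertex.\<close>

definition finite_path :: "('v, 'e) bratteli \<Rightarrow> 'e list \<Rightarrow> bool" where
  "finite_path B f \<longleftrightarrow> f \<noteq> [] \<and> (\<forall>i<length f. f ! i \<in> edges B i) \<and>
     (\<forall>i. Suc i < length f \<longrightarrow> rng B i (f ! i) = src B (Suc i) (f ! Suc i))"

definition endpoint :: "('v, 'e) bratteli \<Rightarrow> 'e list \<Rightarrow> 'v" where
  "endpoint B f = rng B (length f - 1) (last f)"

definition cylinder :: "('v, 'e) bratteli \<Rightarrow> 'e list \<Rightarrow> (nat \<Rightarrow> 'e) set" where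
  "cylinder B f = {x \<in> path_space B. \<forall>i<length f. x i = f ! i}"

definition path_topology :: "('v, 'e) bratteli \<Rightarrow> (nat \<Rightarrow> 'e) topology" where
  "path_topology B = topology_generated_by {cylinder B f | f. finite_path B f}"

lemma topspace_path_topology: "topspace (path_topology B) = path_space B"
proof -
  have "x \<in> \<Union>{cylinder B f | f. finite_path B f}" if "x \<in> path_space B" for x
  proof -
    have "finite_path B [x 0]" and "x \<in> cylinder B [x 0]"
      using that by (simp_all add: finite_path_def cylinder_def path_space_def)
    then show ?thesis by blast
  qed
  moreover have "cylinder B f \<subseteq> path_space B" for f
    unfolding cylinder_def by blast
  ultimately show ?thesis
    unfolding path_topology_def topology_generated_by_topspace by blast
qed

definition borel_measure_on :: "'a topology \<Rightarrow> 'a measure \<Rightarrow> bool" where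
  "borel_measure_on T M \<longleftrightarrow> sets M = sigma_sets (topspace T) {U. openin T U}"

definition tail_equivalence :: "('v, 'e) bratteli \<Rightarrow> ((nat \<Rightarrow> 'e) \<times> (nat \<Rightarrow> 'e)) set" where
  "tail_equivalence B =
     {(x, y). x \<in> path_space B \<and> y \<in> path_space B \<and> (\<exists>N. \<forall>n\<ge>N. x n = y n)}"

definition tail_invariant :: "('v, 'e) bratteli \<Rightarrow> (nat \<Rightarrow> 'e) measure \<Rightarrow> bool" where
  "tail_invariant B M \<longleftrightarrow>
     (\<forall>f g. finite_path B f \<and> finite_path B g \<and> length f = length g \<and>
        endpoint B f = endpoint B g \<longrightarrow> emeasure M (cylinder B f) = emeasure M (cylinder B g))"

definition replace_initial :: "'e list \<Rightarrow> (nat \<Rightarrow> 'e) \<Rightarrow> (nat \<Rightarrow> 'e)" where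
  "replace_initial g x = (\<lambda>i. if i < length g then g ! i else x i)"

text \<open>Invariance under tail equivalence for a measure that may be infinite: exchanging the
  initial segments \<open>f\<close> and \<open>g\<close> preserves the measure of every measurable set of paths, not only of
  whole cylinder sets. For measures that are finite on cylinder sets this amounts to
  \<open>tail_invariant\<close>; the measures considered below may be infinite on every nonempty cylinder set,
  and then equality on cylinder sets alone says nothing.\<close>

definition tail_invariant_on_sets :: "('v, 'e) bratteli \<Rightarrow> (nat \<Rightarrow> 'e) measure \<Rightarrow> bool" where
  "tail_invariant_on_sets B M \<longleftrightarrow>
     (\<forall>f g. finite_path B f \<and> finite_path B g \<and> length f = length g \<and>
        endpoint B f = endpoint B g \<longrightarrow>
        (\<forall>A\<in>sets M. A \<subseteq> cylinder B f \<longrightarrow> emeasure M (replace_initial g ` A) = emeasure M A))"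

text \<open>\<open>saturation B C\<close> is the set of paths of \<open>B\<close> tail equivalent, in \<open>B\<close>, to a path of the
  subdiagram \<open>C\<close>.\<close>

definition saturation ::
    "('v, 'e) bratteli \<Rightarrow> ('v, 'e) bratteli \<Rightarrow> (nat \<Rightarrow> 'e) set" where
  "saturation B C = {x. \<exists>y\<in>path_space C. (x, y) \<in> tail_equivalence B}"

text \<open>These conditions determine \<open>M\<close>: by invariance, the set of paths that begin with \<open>f\<close> and
  continue in \<open>C\<close> has the same measure as the cylinder set in \<open>C\<close> of any path of \<open>C\<close> with the
  length and the endpoint of \<open>f\<close>.\<close>

definition measure_extension ::
    "('v, 'e) bratteli \<Rightarrow> ('v, 'e) bratteli \<Rightarrow> (nat \<Rightarrow> 'e) measure \<Rightarrow> (nat \<Rightarrow> 'e) measure \<Rightarrow> bool"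
  where
  "measure_extension B C N M \<longleftrightarrow>
     borel_measure_on (subtopology (path_topology B) (saturation B C)) M \<and>
     tail_invariant_on_sets B M \<and>
     (\<forall>A\<in>sets N. emeasure M A = emeasure N A)"

end

theory Submission imports Defs begin

text \<open>A path tail equivalent to one of the odometer enters it for good at some level \<open>n + 1\<close>.
  By invariance, the set of paths that have done so by level \<open>n + 1\<close> has measure
  \<open>h\<^sub>n / (a\<^sub>0 \<dots> a\<^sub>n)\<close>, where \<open>h\<^sub>n\<close> is the number of finite paths from level 0 to the vertex 0 of
  level \<open>n + 1\<close>. Every vertex of level \<open>i + 1\<close> receives at most \<open>a\<^sub>i + 2 t\<^sub>i\<close> edges, so these
  measures are bounded by the partial products of \<open>1 + 2 t\<^sub>i / a\<^sub>i\<close>, which converge.\<close>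

text \<open>The index \<open>n\<close> is the level of the last edge, so these paths have
  \<open>n + 1\<close> edges and \<open>v\<close> is a vertex of level \<open>n + 1\<close>.\<close>

definition paths_to :: "('v, 'e) bratteli \<Rightarrow> nat \<Rightarrow> 'v \<Rightarrow> 'e list set" where
  "paths_to B n v = {f. finite_path B f \<and> length f = Suc n \<and> endpoint B f = v}"

definition incoming :: "('v, 'e) bratteli \<Rightarrow> nat \<Rightarrow> 'v \<Rightarrow> 'e set" where
  "incoming B n v = {e \<in> edges B n. rng B n e = v}"

text \<open>The sets on which the extended measure is prescribed. The segment \<open>f\<close> is an
  arbitrary path of \<open>B\<close>; only the edges after it are confined to
  \<open>C\<close>.\<close>

definition cylinder_into ::
    "('v, 'e) bratteli \<Rightarrow> ('v, 'e) bratteli \<Rightarrow> 'e list \<Rightarrow> (nat \<Rightarrow> 'e) set" where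
  "cylinder_into B C f = {x \<in> cylinder B f. \<forall>i\<ge>length f. x i \<in> edges C i}"

section \<open>Counting finite paths\<close>

lemma paths_to_0: "paths_to B 0 v = (\<lambda>e. [e]) ` incoming B 0 v"
  by (auto simp: paths_to_def incoming_def finite_path_def endpoint_def length_Suc_conv)

text \<open>Deleting the last edge \<open>e\<close> leaves a path that ends at the source of
  \<open>e\<close>. Used as a recursive upper bound for the number of paths.\<close>

lemma paths_to_Suc_subset:
  "paths_to B (Suc n) v \<subseteq>
     (\<lambda>(e, f). f @ [e]) ` (SIGMA e:incoming B (Suc n) v. paths_to B n (src B (Suc n) e))"
proof
  fix p assume p: "p \<in> paths_to B (Suc n) v"
  then have len: "length p = Suc (Suc n)" and fp: "finite_path B p" and "endpoint B p = v"
    by (auto simp: paths_to_def)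
  define f e where "f = butlast p" and "e = last p"
  have pfe: "p = f @ [e]" using len by (metis append_butlast_last_id e_def f_def list.size(3) nat.distinct(1))
  then have lf: "length f = Suc n" using len by simp
  have nth_f: "f ! i = p ! i" if "i < Suc n" for i
    using that lf by (simp add: pfe nth_append)
  have nth_e: "e = p ! Suc n"
    using lf by (simp add: pfe nth_append)
  have last_f: "last f = f ! n" using lf by (metis diff_Suc_1 last_conv_nth length_0_conv nat.distinct(1))
  have "e \<in> incoming B (Suc n) v"
    using fp len \<open>endpoint B p = v\<close> by (auto simp: incoming_def nth_e finite_path_def endpoint_def last_conv_nth)
  moreover have "finite_path B f"
    using fp len lf nth_f by (auto simp: finite_path_def)
  moreover have "endpoint B f = src B (Suc n) e"
    using fp len lf nth_f by (simp add: endpoint_def last_f nth_e finite_path_def)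
  ultimately show "p \<in> (\<lambda>(e, f). f @ [e]) `
      (SIGMA e:incoming B (Suc n) v. paths_to B n (src B (Suc n) e))"
    using pfe lf by (force simp: paths_to_def)
qed

text \<open>The bound \<open>d n\<close> on the row sums is uniform in the vertex, so each further
  level contributes one factor, whatever the source of the last edge is. For this the induction must
  range over all \<open>v\<close>.\<close>

lemma card_paths_to_le:
  assumes fin: "\<And>n v. finite (incoming B n v)"
    and card: "\<And>n v. card (incoming B n v) \<le> d n"
  shows "finite (paths_to B n v) \<and> card (paths_to B n v) \<le> (\<Prod>i\<le>n. d i)"
proof (induction n arbitrary: v)
  case 0
  have "card (paths_to B 0 v) \<le> card (incoming B 0 v)"
    unfolding paths_to_0 by (rule card_image_le) (rule fin)
  with card[of 0 v] fin[of 0 v] show ?case by (simp add: paths_to_0)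
next
  case (Suc n)
  let ?S = "SIGMA e:incoming B (Suc n) v. paths_to B n (src B (Suc n) e)"
  have S: "finite ?S" using fin Suc by blast
  have "card (paths_to B (Suc n) v) \<le> card ((\<lambda>(e, f). f @ [e]) ` ?S)"
    using S by (intro card_mono paths_to_Suc_subset) auto
  also have "\<dots> \<le> card ?S"
    using S by (rule card_image_le)
  also have "\<dots> = (\<Sum>e\<in>incoming B (Suc n) v. card (paths_to B n (src B (Suc n) e)))"
    using fin Suc by (intro card_SigmaI) auto
  also have "\<dots> \<le> card (incoming B (Suc n) v) * (\<Prod>i\<le>n. d i)"
    using Suc by (metis (no_types, lifting) of_nat_id sum_bounded_above)
  also have "\<dots> \<le> d (Suc n) * (\<Prod>i\<le>n. d i)"
    using card by (rule mult_right_mono) simp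
  finally show ?case
    using finite_subset[OF paths_to_Suc_subset finite_imageI[OF S]] by (simp add: mult.commute)
qed

text \<open>Counts the finite paths of a diagram with one vertex per level, where the edges can be
  chosen independently.\<close>

lemma card_lists_nth_in:
  assumes "\<And>i. finite (L i)"
  shows "finite {f. length f = n \<and> (\<forall>i<n. f ! i \<in> L i)} \<and>
    card {f. length f = n \<and> (\<forall>i<n. f ! i \<in> L i)} = (\<Prod>i<n. card (L i))"
proof (induction n)
  case 0
  have "{f. length f = 0 \<and> (\<forall>i<0. f ! i \<in> L i)} = {[]}" by auto
  then show ?case by (simp only:) simp
next
  case (Suc n)
  let ?P = "\<lambda>n. {f. length f = n \<and> (\<forall>i<n. f ! i \<in> L i)}"
  have "?P (Suc n) = (\<lambda>(f, e). f @ [e]) ` (?P n \<times> L n)"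
  proof (intro equalityI subsetI)
    fix p assume "p \<in> ?P (Suc n)"
    then have len: "length p = Suc n" and p: "\<And>i. i < Suc n \<Longrightarrow> p ! i \<in> L i" by auto
    have "p = take n p @ [p ! n]"
      using len by (metis lessI order_refl take_Suc_conv_app_nth take_all)
    moreover have "take n p \<in> ?P n" "p ! n \<in> L n" using len p by auto
    ultimately show "p \<in> (\<lambda>(f, e). f @ [e]) ` (?P n \<times> L n)"
      by (intro image_eqI[where x = "(take n p, p ! n)"]) simp_all
  qed (auto simp: nth_append less_Suc_eq)
  moreover have "inj_on (\<lambda>(f, e). f @ [e]) (?P n \<times> L n)"
    by (auto intro: inj_onI)
  ultimately show ?case
    using Suc assms by (simp add: card_image card_cartesian_product)
qed

section \<open>Subdiagrams with a single vertex on every level\<close>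

lemma edges_vertex_subdiagram_singleton:
  "edges (vertex_subdiagram B (\<lambda>n. {v})) n = {e \<in> edges B n. src B n e = v \<and> rng B n e = v}"
  and src_vertex_subdiagram: "src (vertex_subdiagram B W) = src B"
  and rng_vertex_subdiagram: "rng (vertex_subdiagram B W) = rng B"
  by (auto simp: vertex_subdiagram_def)

lemmas subdiagram_simps =
  edges_vertex_subdiagram_singleton src_vertex_subdiagram rng_vertex_subdiagram

text \<open>Every edge of \<open>C\<close> starts and ends at \<open>v\<close>, so any two
  consecutive edges compose. The next lemma is the analogue for finite paths.\<close>

lemma path_space_singleton:
  assumes "C = vertex_subdiagram B (\<lambda>n. {v})"
  shows "path_space C = {x. \<forall>n. x n \<in> edges C n}"
  by (auto simp: path_space_def assms subdiagram_simps)

lemma paths_to_singleton: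
  assumes "C = vertex_subdiagram B (\<lambda>n. {v})"
  shows "paths_to C n v = {f. length f = Suc n \<and> (\<forall>i<Suc n. f ! i \<in> edges C i)}"
proof -
  have "f \<in> paths_to C n v" if "length f = Suc n" and f: "\<forall>i<Suc n. f ! i \<in> edges C i" for f
  proof -
    have "f \<noteq> []" using \<open>length f = Suc n\<close> by auto
    moreover have "src C i (f ! i) = v \<and> rng C i (f ! i) = v" if "i < Suc n" for i
      using f that by (simp add: assms subdiagram_simps)
    ultimately show ?thesis
      using that by (simp add: paths_to_def finite_path_def endpoint_def last_conv_nth)
  qed
  moreover have "length f = Suc n" "\<forall>i<Suc n. f ! i \<in> edges C i" if "f \<in> paths_to C n v" for f
    using that by (simp_all add: paths_to_def finite_path_def)
  ultimately show ?thesis by blast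
qed

text \<open>Both \<open>f\<close> and \<open>g\<close> end at \<open>v\<close> on level
  \<open>n + 1\<close>, so either may precede the same tail in \<open>C\<close>. This gives the set
  the form to which \<open>tail_invariant_on_sets\<close> applies.\<close>

lemma cylinder_into_eq_image:
  assumes C: "C = vertex_subdiagram B (\<lambda>n. {v})"
    and f: "f \<in> paths_to B n v" and g: "g \<in> paths_to C n v"
  shows "cylinder_into B C f = replace_initial f ` cylinder C g"
proof (intro equalityI subsetI)
  have len: "length f = Suc n" "length g = Suc n" using f g by (auto simp: paths_to_def)
  {
    fix x assume x: "x \<in> cylinder_into B C f"
    have "replace_initial g x \<in> cylinder C g"
      using x g len by (auto simp: cylinder_def path_space_singleton[OF C] paths_to_singleton[OF C]
          replace_initial_def cylinder_into_def)
    moreover have "x = replace_initial f (replace_initial g x)"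
      using x len by (auto simp: replace_initial_def cylinder_into_def cylinder_def)
    ultimately show "x \<in> replace_initial f ` cylinder C g" by blast
  next
    fix x assume "x \<in> replace_initial f ` cylinder C g"
    then obtain y where y: "y \<in> cylinder C g" and x: "x = replace_initial f y" by blast
    have yC: "y i \<in> edges C i" for i
      using y by (auto simp: cylinder_def path_space_singleton[OF C])
    then have yB: "y i \<in> edges B i" "src B i (y i) = v" "rng B i (y i) = v" for i
      by (auto simp: C subdiagram_simps)
    have fB: "\<And>i. i < Suc n \<Longrightarrow> f ! i \<in> edges B i"
      "\<And>i. i < n \<Longrightarrow> rng B i (f ! i) = src B (Suc i) (f ! Suc i)"
      "rng B n (f ! n) = v"
      using f len by (auto simp: paths_to_def finite_path_def endpoint_def last_conv_nth)
    \<comment> \<open>The three cases are a position inside \<open>f\<close>, the junction, where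
      \<open>f\<close> ends at \<open>v\<close> and the tail starts at \<open>v\<close>, and a
      position in the tail.\<close>
    have "x i \<in> edges B i \<and> rng B i (x i) = src B (Suc i) (x (Suc i))" for i
      using fB yB len by (cases i n rule: linorder_cases) (auto simp: x replace_initial_def)
    then show "x \<in> cylinder_into B C f"
      using yC len by (auto simp: cylinder_into_def cylinder_def path_space_def x replace_initial_def)
  }
qed

text \<open>The segment \<open>f\<close> is recovered as the first \<open>n + 1\<close> edges of the
  path. In this form the covering of the saturation and the monotonicity in \<open>n\<close> can be
  read off.\<close>

lemma UN_cylinder_into:
  "(\<Union>f\<in>paths_to B n v. cylinder_into B C f) =
     {x \<in> path_space B. rng B n (x n) = v \<and> (\<forall>i>n. x i \<in> edges C i)}"
proof (intro equalityI subsetI)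
  fix x assume "x \<in> {x \<in> path_space B. rng B n (x n) = v \<and> (\<forall>i>n. x i \<in> edges C i)}"
  then have x: "x \<in> path_space B" "rng B n (x n) = v" "\<And>i. i > n \<Longrightarrow> x i \<in> edges C i"
    by auto
  let ?f = "map x [0..<Suc n]"
  have nth_f: "?f ! i = x i" if "i < Suc n" for i
    using that by (simp del: upt_Suc)
  have "?f \<in> paths_to B n v"
    using x nth_f by (auto simp: paths_to_def finite_path_def endpoint_def path_space_def
        last_conv_nth simp del: upt_Suc)
  moreover have "x \<in> cylinder_into B C ?f"
    using x nth_f by (auto simp: cylinder_into_def cylinder_def simp del: upt_Suc)
  ultimately show "x \<in> (\<Union>f\<in>paths_to B n v. cylinder_into B C f)" by blast
next
  fix x assume "x \<in> (\<Union>f\<in>paths_to B n v. cylinder_into B C f)"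
  then obtain f where f: "f \<in> paths_to B n v" and x: "x \<in> cylinder_into B C f" by blast
  then have "length f = Suc n" "rng B n (last f) = v"
    by (auto simp: paths_to_def endpoint_def)
  moreover from this have "last f = f ! n"
    by (metis diff_Suc_1 last_conv_nth list.size(3) nat.distinct(1))
  ultimately show "x \<in> {x \<in> path_space B. rng B n (x n) = v \<and> (\<forall>i>n. x i \<in> edges C i)}"
    using x by (simp add: cylinder_into_def cylinder_def)
qed

text \<open>If a path agrees with one of \<open>C\<close> from index \<open>N\<close> on, its edge
  at \<open>N\<close> already lies in \<open>C\<close> and so ends at \<open>v\<close>. Hence it
  belongs to the \<open>N\<close>-th set.\<close>

lemma saturation_subset_UN_cylinder_into:
  assumes C: "C = vertex_subdiagram B (\<lambda>n. {v})"
  shows "saturation B C \<subseteq> (\<Union>n. \<Union>f\<in>paths_to B n v. cylinder_into B C f)"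
  unfolding UN_cylinder_into
proof
  fix x assume "x \<in> saturation B C"
  then obtain y N where y: "y \<in> path_space C" and x: "x \<in> path_space B"
    and N: "\<And>n. n \<ge> N \<Longrightarrow> x n = y n"
    by (auto simp: saturation_def tail_equivalence_def)
  have "x i \<in> edges C i" if "i \<ge> N" for i
    using y N that by (simp add: path_space_singleton[OF C])
  moreover from this[of N] have "rng B N (x N) = v"
    by (simp add: C subdiagram_simps)
  ultimately show "x \<in> (\<Union>n. {x \<in> path_space B. rng B n (x n) = v \<and> (\<forall>i>n. x i \<in> edges C i)})"
    using x by (intro UN_I[of N]) auto
qed

text \<open>For a path in the \<open>n\<close>-th set the edge at index \<open>n + 1\<close> lies in
  \<open>C\<close>, hence ends at \<open>v\<close> again.\<close>

lemma incseq_UN_cylinder_into: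
  assumes C: "C = vertex_subdiagram B (\<lambda>n. {v})"
  shows "incseq (\<lambda>n. \<Union>f\<in>paths_to B n v. cylinder_into B C f)"
  unfolding UN_cylinder_into by (intro incseq_SucI) (auto simp: C subdiagram_simps)

section \<open>Measures of cylinder sets and of the saturation\<close>

lemma cylinder_in_sets:
  assumes "borel_measure_on (path_topology C) N" and "finite_path C g"
  shows "cylinder C g \<in> sets N"
  using assms unfolding borel_measure_on_def path_topology_def
  by (auto intro!: sigma_sets.Basic topology_generated_by_Basis)

text \<open>\<open>borel_measure_on\<close> speaks of the sigma-algebra alone, but a sigma-algebra
  determines its space.\<close>

lemma space_borel_measure_on_path_topology:
  assumes "borel_measure_on (path_topology C) N"
  shows "space N = path_space C"
proof -
  have "{U. openin (path_topology C) U} \<subseteq> Pow (path_space C)"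
    using openin_subset topspace_path_topology by fastforce
  then have "sets N = sets (sigma (path_space C) {U. openin (path_topology C) U})"
    using assms by (simp add: borel_measure_on_def topspace_path_topology)
  then show ?thesis
    using sets_eq_imp_space_eq by (metis space_measure_of_conv)
qed

text \<open>The cylinder sets of length \<open>n + 1\<close> partition the space, and by invariance
  they have equal measure, since all their paths end at \<open>v\<close>. The product form avoids
  division in \<open>ennreal\<close> and shows at once that the measure is not 0.\<close>

lemma emeasure_cylinder_singleton:
  assumes C: "C = vertex_subdiagram B (\<lambda>n. {v})"
    and borel: "borel_measure_on (path_topology C) N" and "prob_space N" and inv: "tail_invariant C N"
    and fin: "\<And>n. finite (edges C n)"
    and g: "g \<in> paths_to C n v"
  shows "of_nat (\<Prod>i\<le>n. card (edges C i)) * emeasure N (cylinder C g) = 1"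
proof -
  let ?P = "paths_to C n v"
  have fp: "finite ?P" and card: "card ?P = (\<Prod>i\<le>n. card (edges C i))"
    using card_lists_nth_in[of "edges C" "Suc n", OF fin]
    by (simp_all add: paths_to_singleton[OF C] lessThan_Suc_atMost)
  have "space N = (\<Union>f\<in>?P. cylinder C f)"
  proof -
    have "x \<in> (\<Union>f\<in>?P. cylinder C f)" if "x \<in> path_space C" for x
    proof (rule UN_I)
      show "map x [0..<Suc n] \<in> ?P"
        using that by (auto simp: paths_to_singleton[OF C] path_space_singleton[OF C] simp del: upt_Suc)
      show "x \<in> cylinder C (map x [0..<Suc n])"
        using that by (auto simp: cylinder_def simp del: upt_Suc)
    qed
    then show ?thesis
      by (auto simp: space_borel_measure_on_path_topology[OF borel] cylinder_def)
  qed
  moreover have "disjoint_family_on (cylinder C) ?P"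
  proof (unfold disjoint_family_on_def, intro ballI impI)
    fix f h assume "f \<in> ?P" "h \<in> ?P" "f \<noteq> h"
    then obtain i where "i < Suc n" "f ! i \<noteq> h ! i" "length f = Suc n" "length h = Suc n"
      by (auto simp: paths_to_def list_eq_iff_nth_eq)
    then show "cylinder C f \<inter> cylinder C h = {}" by (auto simp: cylinder_def)
  qed
  ultimately have "(\<Sum>f\<in>?P. emeasure N (cylinder C f)) = emeasure N (space N)"
    using fp cylinder_in_sets[OF borel] by (simp add: sum_emeasure paths_to_def image_subset_iff)
  also have "\<dots> = 1"
    by (rule prob_space.emeasure_space_1) fact
  also have "(\<Sum>f\<in>?P. emeasure N (cylinder C f)) = (\<Sum>f\<in>?P. emeasure N (cylinder C g))"
  proof (rule sum.cong)
    fix f assume "f \<in> ?P"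
    then show "emeasure N (cylinder C f) = emeasure N (cylinder C g)"
      using inv g unfolding tail_invariant_def paths_to_def by (metis (mono_tags) mem_Collect_eq)
  qed simp
  finally show ?thesis by (simp add: card)
qed

lemma emeasure_cylinder_into:
  assumes C: "C = vertex_subdiagram B (\<lambda>n. {v})"
    and borel: "borel_measure_on (path_topology C) N"
    and ext: "measure_extension B C N M"
    and f: "f \<in> paths_to B n v" and g: "g \<in> paths_to C n v"
    and pos: "emeasure N (cylinder C g) \<noteq> 0"
  shows "cylinder_into B C f \<in> sets M"
    and "emeasure M (cylinder_into B C f) = emeasure N (cylinder C g)"
proof -
  have gB: "finite_path B g" "endpoint B g = v" "length g = Suc n"
    using g by (auto simp: C paths_to_def finite_path_def endpoint_def subdiagram_simps)
  have fB: "finite_path B f" "endpoint B f = v" "length f = Suc n"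
    using f by (auto simp: paths_to_def)
  have "cylinder C g \<in> sets N"
    using g by (intro cylinder_in_sets[OF borel]) (simp add: paths_to_def)
  then have eq: "emeasure M (cylinder C g) = emeasure N (cylinder C g)"
    using ext by (simp add: measure_extension_def)
  \<comment> \<open>\<open>emeasure\<close> is 0 outside the sigma-algebra, so a nonzero value
    proves measurability. The same argument gives the measurability of
    \<open>cylinder_into B C f\<close> at the end.\<close>
  then have "cylinder C g \<in> sets M"
    using pos by (metis emeasure_notin_sets)
  moreover have "cylinder C g \<subseteq> cylinder B g"
    by (auto simp: cylinder_def path_space_def C subdiagram_simps)
  \<comment> \<open>Invariance is applied to exchange the initial segment \<open>g\<close> for
    \<open>f\<close>.\<close>
  ultimately have "emeasure M (replace_initial f ` cylinder C g) = emeasure M (cylinder C g)"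
    using ext fB gB unfolding measure_extension_def tail_invariant_on_sets_def by metis
  then show *: "emeasure M (cylinder_into B C f) = emeasure N (cylinder C g)"
    by (simp add: cylinder_into_eq_image[OF C f g] eq)
  show "cylinder_into B C f \<in> sets M"
    using pos * by (metis emeasure_notin_sets)
qed

text \<open>\<open>K\<close> bounds the ratio of the number of paths of \<open>B\<close> to the
  number of paths of \<open>C\<close> ending at \<open>v\<close>. This ratio bounds the measure of
  the \<open>n\<close>-th set of the increasing cover, and continuity from below passes to the
  union.\<close>

lemma emeasure_saturation_le:
  assumes C: "C = vertex_subdiagram B (\<lambda>n. {v})"
    and borel: "borel_measure_on (path_topology C) N" and prob: "prob_space N" and inv: "tail_invariant C N"
    and ext: "measure_extension B C N M"
    and fin: "\<And>n. finite (edges C n)" and ne: "\<And>n. edges C n \<noteq> {}"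
    and finB: "\<And>n. finite (paths_to B n v)"
    and le: "\<And>n. real (card (paths_to B n v)) \<le> K * real (\<Prod>i\<le>n. card (edges C i))"
  shows "emeasure M (saturation B C) \<le> ennreal K"
proof -
  define T where "T n = (\<Union>f\<in>paths_to B n v. cylinder_into B C f)" for n
  have T: "T n \<in> sets M \<and> emeasure M (T n) \<le> ennreal K" for n
  proof -
    \<comment> \<open>An arbitrary edge on each level provides a reference path \<open>g\<close> of
      \<open>C\<close>.\<close>
    define s where "s i = (SOME e. e \<in> edges C i)" for i
    have s: "s i \<in> edges C i" for i
      using ne[of i] unfolding s_def by (simp add: some_in_eq)
    define g where "g = map s [0..<Suc n]"
    have g: "g \<in> paths_to C n v"
      using s by (auto simp: g_def paths_to_singleton[OF C] simp del: upt_Suc)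
    define p where "p = (\<Prod>i\<le>n. card (edges C i))"
    define c where "c = emeasure N (cylinder C g)"
    have pc: "of_nat p * c = 1"
      unfolding p_def c_def by (rule emeasure_cylinder_singleton[OF C borel prob inv fin g])
    then have "c \<noteq> 0" by auto
    have into: "cylinder_into B C f \<in> sets M" "emeasure M (cylinder_into B C f) = c"
      if "f \<in> paths_to B n v" for f
      using emeasure_cylinder_into[OF C borel ext that g] \<open>c \<noteq> 0\<close> by (auto simp: c_def)
    have "p > 0" using pc by (cases "p = 0") simp_all
    \<comment> \<open>\<open>ennreal\<close> sends negative reals to 0, so the sign of
      \<open>K\<close> must be known before \<open>ennreal (K * real p)\<close> is split into
      factors.\<close>
    then have K: "K \<ge> 0"
      using order_trans[OF of_nat_0_le_iff le[of n]] unfolding p_def[symmetric]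
      by (simp add: zero_le_mult_iff)
    have "emeasure M (T n) \<le> (\<Sum>f\<in>paths_to B n v. emeasure M (cylinder_into B C f))"
      unfolding T_def using finB into by (intro emeasure_subadditive_finite) auto
    also have "\<dots> = of_nat (card (paths_to B n v)) * c"
      using into by simp
    also have "\<dots> \<le> ennreal (K * real p) * c"
      using le[of n] unfolding p_def[symmetric]
      by (intro mult_right_mono) (auto simp: ennreal_of_nat_eq_real_of_nat intro: ennreal_leI)
    also have "\<dots> = ennreal K * (of_nat p * c)"
      using K by (simp add: ennreal_mult ennreal_of_nat_eq_real_of_nat mult.assoc)
    finally show ?thesis
      using pc finB into by (auto simp: T_def intro!: sets.finite_UN)
  qed
  have "emeasure M (saturation B C) \<le> emeasure M (\<Union>n. T n)"
    using T saturation_subset_UN_cylinder_into[OF C] by (intro emeasure_mono) (auto simp: T_def)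
  also have "\<dots> = (SUP n. emeasure M (T n))"
    using T incseq_UN_cylinder_into[OF C] by (intro SUP_emeasure_incseq[symmetric]) (auto simp: T_def[abs_def])
  also have "\<dots> \<le> ennreal K"
    using T by (intro SUP_least) auto
  finally show ?thesis .
qed

section \<open>Incidence matrices of finite bandwidth\<close>

text \<open>The possible sources form a window of \<open>2 * t + 1\<close> vertices. Each sends at
  most one edge to \<open>v\<close>, except that 0 may send \<open>a\<close> of them.\<close>

lemma incoming_banded:
  fixes B :: "(int, 'e) bratteli"
  assumes gbd: "generalized_bratteli_diagram B" and V: "\<And>n. verts B n = UNIV"
    and origin: "incidence B n 0 0 = a" "a > 0"
    and inside: "\<And>v w. (v, w) \<noteq> (0, 0) \<Longrightarrow> \<bar>v - w\<bar> \<le> int t \<Longrightarrow> incidence B n v w = 1"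
    and outside: "\<And>v w. \<bar>v - w\<bar> > int t \<Longrightarrow> incidence B n v w = 0"
  shows "finite (incoming B n v) \<and> card (incoming B n v) \<le> a + 2 * t"
proof -
  let ?E = "\<lambda>w. {e \<in> edges B n. src B n e = w \<and> rng B n e = v}"
  let ?I = "{v - int t..v + int t}"
  have finE: "finite (?E w)" for w
    using gbd V by (simp add: generalized_bratteli_diagram_def)
  have sub: "incoming B n v \<subseteq> (\<Union>w\<in>?I. ?E w)"
  proof
    fix e assume e: "e \<in> incoming B n v"
    \<comment> \<open>Finiteness matters here: \<open>card\<close> would be 0 on an infinite
      set.\<close>
    then have "incidence B n v (src B n e) \<noteq> 0"
      using finE[of "src B n e"] by (auto simp: incidence_def incoming_def)
    then have "\<bar>v - src B n e\<bar> \<le> int t" using outside by (meson not_le)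
    then show "e \<in> (\<Union>w\<in>?I. ?E w)" using e by (auto simp: incoming_def)
  qed
  have fU: "finite (\<Union>w\<in>?I. ?E w)" using finE by blast
  have "card (incoming B n v) \<le> card (\<Union>w\<in>?I. ?E w)"
    using fU sub by (rule card_mono)
  also have "\<dots> \<le> (\<Sum>w\<in>?I. incidence B n v w)"
    unfolding incidence_def by (rule card_UN_le) simp
  \<comment> \<open>The excess \<open>a - 1\<close> is charged to the source 0 for every
    \<open>v\<close>, which makes the bound independent of \<open>v\<close>.\<close>
  also have "\<dots> \<le> (\<Sum>w\<in>?I. 1 + (if w = 0 then a - 1 else 0))"
  proof (rule sum_mono)
    fix w assume "w \<in> ?I"
    then show "incidence B n v w \<le> 1 + (if w = 0 then a - 1 else 0)"
      using origin inside[of v w] by (cases "(v, w) = (0, 0)") auto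
  qed
  also have "\<dots> \<le> (2 * t + 1) + (a - 1)"
    unfolding sum.distrib by (intro add_mono) auto
  also have "\<dots> = a + 2 * t" using origin by simp
  finally show ?thesis using finite_subset[OF sub fU] by blast
qed

text \<open>Each factor is \<open>(1 + b i / a i) * a i\<close>, and \<open>1 + x\<close> is at most
  \<open>exp x\<close>. The exponents add up to a partial sum of a nonnegative series.\<close>

lemma prod_add_le_exp_suminf:
  fixes a b :: "nat \<Rightarrow> real"
  assumes a: "\<And>i. a i > 0" and b: "\<And>i. b i \<ge> 0" and "summable (\<lambda>i. b i / a i)"
  shows "(\<Prod>i\<le>n. a i + b i) \<le> exp (\<Sum>i. b i / a i) * (\<Prod>i\<le>n. a i)"
proof -
  have "(\<Prod>i\<le>n. a i + b i) \<le> (\<Prod>i\<le>n. exp (b i / a i) * a i)"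
  proof (intro prod_mono conjI)
    fix i
    show "0 \<le> a i + b i" using a[of i] b[of i] by simp
    have "a i + b i = (1 + b i / a i) * a i" using a[of i] by (simp add: field_simps)
    also have "\<dots> \<le> exp (b i / a i) * a i"
      using a[of i] by (intro mult_right_mono exp_ge_add_one_self) simp
    finally show "a i + b i \<le> exp (b i / a i) * a i" .
  qed
  also have "\<dots> = exp (\<Sum>i\<le>n. b i / a i) * (\<Prod>i\<le>n. a i)"
    by (simp add: prod.distrib exp_sum)
  also have "\<dots> \<le> exp (\<Sum>i. b i / a i) * (\<Prod>i\<le>n. a i)"
    using assms by (intro mult_right_mono prod_nonneg)
      (auto intro!: sum_le_suminf simp: less_imp_le)
  finally show ?thesis .
qed

theorem theorem4p15:
  fixes a t :: "nat \<Rightarrow> nat"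
    and B Bbar :: "(int, 'e) bratteli"
    and \<nu> \<nu>hat :: "(nat \<Rightarrow> 'e) measure"
  assumes "incseq a" and "incseq t" and "\<And>n. a n > 1"
    and "generalized_bratteli_diagram B"
    and "\<And>n. verts B n = UNIV"
    and "\<And>n. incidence B n 0 0 = a n"
    and "\<And>n v w. (v, w) \<noteq> (0, 0) \<Longrightarrow> \<bar>v - w\<bar> \<le> int (t n) \<Longrightarrow> incidence B n v w = 1"
    and "\<And>n v w. \<bar>v - w\<bar> > int (t n) \<Longrightarrow> incidence B n v w = 0"
    and "Bbar = vertex_subdiagram B (\<lambda>n. {0})"
    and "borel_measure_on (path_topology Bbar) \<nu>"
    and "prob_space \<nu>"
    and "tail_invariant Bbar \<nu>"
    and "measure_extension B Bbar \<nu> \<nu>hat"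
    and "summable (\<lambda>n. real (t n) / real (a n))"
  shows "emeasure \<nu>hat (saturation B Bbar) < \<infinity>"
proof -
  have a: "a n > 0" for n using assms(3)[of n] by simp
  \<comment> \<open>The edges of the odometer are exactly those counted by the entry at
    \<open>(0, 0)\<close>.\<close>
  have card_edges: "card (edges Bbar n) = a n" for n
    using assms(6)[of n] by (simp add: assms(9) subdiagram_simps incidence_def)
  have incoming: "finite (incoming B n v) \<and> card (incoming B n v) \<le> a n + 2 * t n" for n v
    using assms(4-8) a by (intro incoming_banded) auto
  have paths: "finite (paths_to B n 0) \<and> card (paths_to B n 0) \<le> (\<Prod>i\<le>n. a i + 2 * t i)" for n
    using incoming by (intro card_paths_to_le) auto
  \<comment> \<open>The numerators \<open>2 * t i\<close> are the surplus of the row-sum bound over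
    the \<open>a i\<close> edges of the odometer.\<close>
  define K where "K = exp (\<Sum>i. real (2 * t i) / real (a i))"
  have "real (card (paths_to B n 0)) \<le> K * real (\<Prod>i\<le>n. card (edges Bbar i))" for n
  proof -
    have "real (card (paths_to B n 0)) \<le> real (\<Prod>i\<le>n. a i + 2 * t i)"
      using paths of_nat_le_iff by blast
    also have "\<dots> = (\<Prod>i\<le>n. real (a i) + real (2 * t i))"
      by simp
    also have "\<dots> \<le> K * (\<Prod>i\<le>n. real (a i))"
      unfolding K_def using a summable_mult[OF assms(14), of 2]
      by (intro prod_add_le_exp_suminf) auto
    finally show ?thesis by (simp add: card_edges)
  qed
  moreover have "finite (edges Bbar n)" "edges Bbar n \<noteq> {}" for n
    using card_edges[of n] a[of n] by (auto intro: card_ge_0_finite)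
  ultimately have "emeasure \<nu>hat (saturation B Bbar) \<le> ennreal K"
    using paths by (intro emeasure_saturation_le[OF assms(9-13)]) simp_all
  then show ?thesis
    using ennreal_less_top[of K] by (simp add: order_le_less_trans)
qed

end
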